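(* Let $1\leq p<\infty$, $0<\kappa<1$ and $n\in\mathbb N$. If $f\in WL^{p,\kappa}(\mathbb R^n)\cap L^\infty(\mathbb R^n)$, then for every $q$ with $p<q<\infty$ we have $f\in L^{q,\kappa}(\mathbb R^n)$, and $$\|f\|_{L^{q,\kappa}}\leq\left(\frac{q}{q-p}\right)^{1/q}\cdot\big(\|f\|_{WL^{p,\kappa}}\big)^{p/q}\cdot\big(\|f\|_{L^\infty}\big)^{1-p/q}.$$
   Context: $\mathbb R^n$ carries Lebesgue measure, and $|E|$ denotes the Lebesgue measure of $E\subset\mathbb R^n$. Cubes have sides parallel to the coordinate axes. For $1\leq p<\infty$ and $0\leq\kappa\leq1$, the Morrey space $L^{p,\kappa}(\mathbb R^n)$ is the set of locally integrable functions $f$ on $\mathbb R^n$ such that $$\|f\|_{L^{p,\kappa}}:=\sup_{Q\subset\mathbb R^n}\bigg(\frac{1}{|Q|^{\kappa}}\int_{Q}|f(y)|^p\,dy\bigg)^{1/p}<+\infty,$$ where the supremum is taken over all cubes $Q$ in $\mathbb R^n$. The weak Morrey space $WL^{p,\kappa}(\mathbb R^n)$ is the set of measurable functions $f$ on $\mathbb R^n$ such that $$\|f\|_{WL^{p,\kappa}}:=\sup_{Q\subset\mathbb R^n}\sup_{\lambda>0}\frac{1}{|Q|^{\kappa/p}}\,\lambda\cdot\big|\big\{y\in Q:|f(y)|>\lambda\big\}\big|^{1/p}<+\infty,$$ where the suprema are taken over all cubes $Q\subset\mathbb R^n$ and all $\lambda>0$. $\|f\|_{L^\infty}$ is the essential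 supremum of $|f|$ over $\mathbb R^n$, and $L^\infty(\mathbb R^n)$ is the set of measurable functions for which it is finite. *)

theory Defs
  imports "HOL-Analysis.Analysis" "HOL-Probability.Essential_Supremum"
begin

text \<open>
  Functions take values in a type of sort \<open>{real_normed_field, euclidean_space}\<close>, which covers
  both \<open>real\<close> and \<open>complex\<close>. Measurability, integrals and measures refer to the
  completed measure \<open>lebesgue\<close>. Norms are \<open>ennreal\<close>-valued, so that they are defined also for
  functions outside the corresponding space.
\<close>

text \<open>Only used with exponents \<open>a > 0\<close>, for which \<open>\<infinity>\<^sup>a = \<infinity>\<close> and \<open>0\<^sup>a = 0\<close>.\<close>

definition ennreal_powr :: "ennreal \<Rightarrow> real \<Rightarrow> ennreal" (infixr "powr\<^sub>e" 80) where
  "x powr\<^sub>e a = (if x = top then top else ennreal (enn2real x powr a))"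

text \<open>Cubes are closed and nondegenerate; since faces are null sets and a closed cube
  and its interior have the same measure, open cubes would give the same suprema.\<close>

definition cubes :: "(real ^ 'n) set set" where
  "cubes = {cbox a (a + (\<chi> i. l)) | a l. 0 < l}"

definition locally_integrable ::
  "(real ^ 'n \<Rightarrow> 'b::{real_normed_field, euclidean_space}) \<Rightarrow> bool" where
  "locally_integrable f \<longleftrightarrow> (\<forall>K. compact K \<longrightarrow> f absolutely_integrable_on K)"

definition morrey_norm ::
  "real \<Rightarrow> real \<Rightarrow> (real ^ 'n \<Rightarrow> 'b::{real_normed_field, euclidean_space}) \<Rightarrow> ennreal" where
  "morrey_norm p \<kappa> f =
    (SUP Q\<in>cubes. (ennreal (1 / measure lebesgue Q powr \<kappa>) *
       (\<integral>\<^sup>+y\<in>Q. ennreal (norm (f y) powr p) \<partial>lebesgue)) powr\<^sub>e (1 / p))"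

definition morrey_space ::
  "real \<Rightarrow> real \<Rightarrow> (real ^ 'n \<Rightarrow> 'b::{real_normed_field, euclidean_space}) set" where
  "morrey_space p \<kappa> = {f. locally_integrable f \<and> morrey_norm p \<kappa> f < top}"

text \<open>The level sets below lie in a cube, so their measure is finite and \<open>measure\<close> loses nothing
  compared with \<open>emeasure\<close>.\<close>

definition weak_morrey_norm ::
  "real \<Rightarrow> real \<Rightarrow> (real ^ 'n \<Rightarrow> 'b::{real_normed_field, euclidean_space}) \<Rightarrow> ennreal" where
  "weak_morrey_norm p \<kappa> f =
    (SUP Q\<in>cubes. SUP t\<in>{0<..}.
       ennreal (1 / measure lebesgue Q powr (\<kappa> / p) * t *
         measure lebesgue {y \<in> Q. norm (f y) > t} powr (1 / p)))"

definition weak_morrey_space ::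
  "real \<Rightarrow> real \<Rightarrow> (real ^ 'n \<Rightarrow> 'b::{real_normed_field, euclidean_space}) set" where
  "weak_morrey_space p \<kappa> = {f. f \<in> borel_measurable lebesgue \<and> weak_morrey_norm p \<kappa> f < top}"

definition Linfty_norm ::
  "(real ^ 'n \<Rightarrow> 'b::{real_normed_field, euclidean_space}) \<Rightarrow> ennreal" where
  "Linfty_norm f = esssup lebesgue (\<lambda>x. ennreal (norm (f x)))"

definition Linfty_space ::
  "(real ^ 'n \<Rightarrow> 'b::{real_normed_field, euclidean_space}) set" where
  "Linfty_space = {f. f \<in> borel_measurable lebesgue \<and> Linfty_norm f < top}"

end

theory Submission
  imports Defs
begin

text \<open>
  Fix a cube \<open>Q\<close> and write \<open>W\<close> for the weak Morrey norm and \<open>L\<close> for the essential supremum. By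
  definition of \<open>W\<close> the level sets of \<open>f\<close> satisfy
  \<open>\<bar>{y \<in> Q. \<bar>f y\<bar> > t}\<bar> \<le> W\<^sup>p \<bar>Q\<bar>\<^sup>\<kappa> t\<^sup>-\<^sup>p\<close>, and they are null for \<open>t \<ge> L\<close>. In the layer-cake formula
  the integral of \<open>\<bar>f\<bar>\<^sup>q\<close> over \<open>Q\<close> therefore only sees heights \<open>0 < t < L\<close>, and inserting the weak
  bound leaves \<open>q W\<^sup>p \<bar>Q\<bar>\<^sup>\<kappa>\<close> times the integral of \<open>t\<^bsup>q-p-1\<^esup>\<close> over \<open>(0, L)\<close>. The latter converges at \<open>0\<close>
  exactly because \<open>q > p\<close>, with value \<open>L\<^bsup>q-p\<^esup> / (q - p)\<close>. Dividing by \<open>\<bar>Q\<bar>\<^sup>\<kappa>\<close>, taking \<open>q\<close>-th roots and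
  the supremum over \<open>Q\<close> gives the inequality. Local integrability comes from boundedness alone.

  The cube enters the argument only through the bound on the level sets, so the integral estimate
  is an interpolation inequality between weak \<open>L\<^sup>p\<close> and \<open>L\<^sup>\<infinity>\<close> on an arbitrary \<open>\<sigma>\<close>-finite measure space
  (\<open>nn_integral_powr_le_of_weak_bound\<close>), applied to \<open>\<bar>f\<bar>\<close> cut off outside \<open>Q\<close>.
\<close>

section \<open>Powers of extended nonnegative reals\<close>

lemma ennreal_powr_ennreal: "0 \<le> x \<Longrightarrow> ennreal x powr\<^sub>e a = ennreal (x powr a)"
  by (simp add: ennreal_powr_def)

lemma ennreal_powr_mono:
  assumes "x \<le> y" "0 \<le> a"
  shows "x powr\<^sub>e a \<le> y powr\<^sub>e a"
proof (cases "y = top")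
  case True
  then show ?thesis by (simp add: ennreal_powr_def)
next
  case False
  then have "y < top" by (simp add: less_top)
  moreover from this assms(1) have "x \<noteq> top" by auto
  ultimately show ?thesis
    using assms by (auto simp: ennreal_powr_def intro!: ennreal_leI powr_mono2 enn2real_mono)
qed

lemma le_enn2real_if_ennreal_le:
  assumes "ennreal x \<le> y" "y < top"
  shows "x \<le> enn2real y"
  using assms by (metis enn2real_nonneg ennreal_enn2real ennreal_le_iff)

section \<open>The layer-cake formula for bounded functions\<close>

text \<open>Tonelli's theorem is needed for the Lebesgue measure, which is a completion.\<close>

lemma sigma_finite_completion:
  assumes "sigma_finite_measure M"
  shows "sigma_finite_measure (completion M)"
proof -
  interpret sigma_finite_measure M by fact
  obtain A where A: "countable A" "A \<subseteq> sets M" "\<Union>A = space M" "\<forall>a\<in>A. emeasure M a \<noteq> \<infinity>"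
    using sigma_finite_countable by auto
  show ?thesis
  proof (unfold_locales, intro exI conjI)
    show "countable A" "\<Union>A = space (completion M)" using A by auto
    show "A \<subseteq> sets (completion M)" using A(2) sets_completionI_sets by blast
    show "\<forall>a\<in>A. emeasure (completion M) a \<noteq> \<infinity>"
      using A(2,4) by auto
  qed
qed

lemma nn_integral_powr_Ioo:
  assumes "-1 < a" "0 \<le> c"
  shows "(\<integral>\<^sup>+t\<in>{0<..<c}. ennreal (t powr a) \<partial>lborel) = ennreal (c powr (a + 1) / (a + 1))"
proof -
  have "((\<lambda>t. t powr a) has_integral (c powr (a + 1) / (a + 1))) {0<..<c}"
    using has_integral_powr_from_0[OF assms] by (simp add: has_integral_Icc_iff_Ioo)
  then have "((\<lambda>t. t powr a * indicator {0<..<c} t) has_integral (c powr (a + 1) / (a + 1))) UNIV"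
    by (subst (asm) has_integral_restrict_UNIV[symmetric])
       (simp add: indicator_def of_bool_def if_distrib cong: if_cong)
  then have "(\<integral>\<^sup>+t. ennreal (t powr a * indicator {0<..<c} t) \<partial>lborel) = ennreal (c powr (a + 1) / (a + 1))"
    by (intro nn_integral_has_integral_lborel) auto
  then show ?thesis
    by (simp add: ennreal_mult'' ennreal_indicator)
qed

text \<open>
  Write \<open>g x powr q\<close> as the integral of \<open>q * t powr (q - 1)\<close> over \<open>0 < t < g x\<close> and exchange the
  order of integration. The upper bound on \<open>g\<close> allows the heights to be cut at \<open>c\<close>; without that cut
  a bound of order \<open>t powr - p\<close> on the level sets would give an integral diverging at infinity when
  \<open>p < q\<close>.
\<close>

lemma truncated_layer_cake:
  fixes g :: "'a \<Rightarrow> real"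
  assumes sf: "sigma_finite_measure M"
    and meas [measurable]: "g \<in> borel_measurable M"
    and bound: "AE x in M. 0 \<le> g x \<and> g x \<le> c"
    and q: "0 < q"
  shows "(\<integral>\<^sup>+x. ennreal (g x powr q) \<partial>M) =
    (\<integral>\<^sup>+t\<in>{0<..<c}. ennreal (q * t powr (q - 1)) * emeasure M {x \<in> space M. t < g x} \<partial>lborel)"
proof -
  interpret M: sigma_finite_measure M by fact
  interpret P: pair_sigma_finite M lborel by unfold_locales
  let ?h = "\<lambda>x t. ennreal (q * t powr (q - 1)) * indicator {0<..<c} t * indicator {t<..} (g x)"
  have pointwise: "ennreal (a powr q) =
      (\<integral>\<^sup>+t. ennreal (q * t powr (q - 1)) * indicator {0<..<c} t * indicator {t<..} a \<partial>lborel)"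
    if "0 \<le> a" "a \<le> c" for a
  proof -
    have "ennreal (a powr q) = ennreal q * ennreal (a powr (q - 1 + 1) / (q - 1 + 1))"
      using q by (subst ennreal_mult'[symmetric]) auto
    also have "\<dots> = ennreal q * (\<integral>\<^sup>+t\<in>{0<..<a}. ennreal (t powr (q - 1)) \<partial>lborel)"
      using q that(1) by (subst nn_integral_powr_Ioo) auto
    also have "\<dots> = (\<integral>\<^sup>+t. ennreal q * (ennreal (t powr (q - 1)) * indicator {0<..<a} t) \<partial>lborel)"
      by (subst nn_integral_cmult) auto
    also have "\<dots> =
        (\<integral>\<^sup>+t. ennreal (q * t powr (q - 1)) * indicator {0<..<c} t * indicator {t<..} a \<partial>lborel)"
      using q that(2) by (intro nn_integral_cong) (auto simp: indicator_def ennreal_mult')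
    finally show ?thesis .
  qed
  have hm: "case_prod ?h \<in> borel_measurable (M \<Otimes>\<^sub>M lborel)"
    unfolding indicator_def greaterThan_iff of_bool_def by measurable
  have "(\<integral>\<^sup>+x. ennreal (g x powr q) \<partial>M) = (\<integral>\<^sup>+x. (\<integral>\<^sup>+t. ?h x t \<partial>lborel) \<partial>M)"
  proof (rule nn_integral_cong_AE)
    show "AE x in M. ennreal (g x powr q) = (\<integral>\<^sup>+t. ?h x t \<partial>lborel)"
      using bound by eventually_elim (rule pointwise; blast)
  qed
  also have "\<dots> = (\<integral>\<^sup>+t. (\<integral>\<^sup>+x. ?h x t \<partial>M) \<partial>lborel)"
    by (rule P.Fubini'[OF hm, symmetric])
  also have "\<dots> = (\<integral>\<^sup>+t\<in>{0<..<c}. ennreal (q * t powr (q - 1)) * emeasure M {x \<in> space M. t < g x} \<partial>lborel)"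
  proof (intro nn_integral_cong)
    fix t :: real
    have "(\<integral>\<^sup>+x. ?h x t \<partial>M) =
        (\<integral>\<^sup>+x. ennreal (q * t powr (q - 1)) * indicator {0<..<c} t * indicator {x \<in> space M. t < g x} x \<partial>M)"
      by (intro nn_integral_cong) (auto simp: indicator_def)
    also have "\<dots> = ennreal (q * t powr (q - 1)) * indicator {0<..<c} t * emeasure M {x \<in> space M. t < g x}"
      by (subst nn_integral_cmult_indicator) auto
    finally show "(\<integral>\<^sup>+x. ?h x t \<partial>M) =
        ennreal (q * t powr (q - 1)) * emeasure M {x \<in> space M. t < g x} * indicator {0<..<c} t"
      by (simp add: mult_ac)
  qed
  finally show ?thesis .
qed

section \<open>Interpolation between weak and uniform bounds\<close>

text \<open>
  Inserting the level set bound into the layer-cake formula leaves the integrand \<open>t powr (q - p - 1)\<close>,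
  whose exponent exceeds \<open>-1\<close> because \<open>p < q\<close>. The factor \<open>1 / (q - p)\<close> blows up as \<open>q\<close> approaches \<open>p\<close>,
  as it must: even a bounded function in weak \<open>L\<^sup>p\<close> can fail to be in \<open>L\<^sup>p\<close>.
\<close>

lemma nn_integral_powr_le_of_weak_bound:
  fixes g :: "'a \<Rightarrow> real"
  assumes sf: "sigma_finite_measure M"
    and meas: "g \<in> borel_measurable M"
    and bound: "AE x in M. 0 \<le> g x \<and> g x \<le> c"
    and c: "0 \<le> c" and A: "0 \<le> A" and p: "0 \<le> p" and pq: "p < q"
    and weak: "\<And>t. 0 < t \<Longrightarrow> emeasure M {x \<in> space M. t < g x} \<le> ennreal (A * t powr - p)"
  shows "(\<integral>\<^sup>+x. ennreal (g x powr q) \<partial>M) \<le> ennreal (q / (q - p) * A * c powr (q - p))"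
proof -
  have "(\<integral>\<^sup>+x. ennreal (g x powr q) \<partial>M) =
      (\<integral>\<^sup>+t\<in>{0<..<c}. ennreal (q * t powr (q - 1)) * emeasure M {x \<in> space M. t < g x} \<partial>lborel)"
    using p pq by (intro truncated_layer_cake sf meas bound) auto
  also have "\<dots> \<le> (\<integral>\<^sup>+t. ennreal (q * A) * (ennreal (t powr (q - p - 1)) * indicator {0<..<c} t) \<partial>lborel)"
  proof (intro nn_integral_mono)
    fix t :: real
    show "ennreal (q * t powr (q - 1)) * emeasure M {x \<in> space M. t < g x} * indicator {0<..<c} t
        \<le> ennreal (q * A) * (ennreal (t powr (q - p - 1)) * indicator {0<..<c} t)"
    proof (cases "t \<in> {0<..<c}")
      case True
      have "t powr (q - 1) * t powr - p = t powr (q - p - 1)"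
        by (simp add: powr_add[symmetric] algebra_simps)
      then have eq: "q * t powr (q - 1) * (A * t powr - p) = q * A * t powr (q - p - 1)"
        by (metis mult.assoc mult.left_commute)
      have "ennreal (q * t powr (q - 1)) * emeasure M {x \<in> space M. t < g x}
          \<le> ennreal (q * t powr (q - 1)) * ennreal (A * t powr - p)"
        using True weak by (intro mult_left_mono) auto
      also have "\<dots> = ennreal (q * A * t powr (q - p - 1))"
        using p pq A by (subst ennreal_mult[symmetric]) (auto simp: eq)
      finally show ?thesis
        using True p pq A by (simp add: ennreal_mult'')
    qed simp
  qed
  also have "\<dots> = ennreal (q * A) * ennreal (c powr (q - p) / (q - p))"
    using nn_integral_powr_Ioo[of "q - p - 1" c] pq c by (subst nn_integral_cmult) auto
  also have "\<dots> = ennreal (q / (q - p) * A * c powr (q - p))"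
    using p pq A by (subst ennreal_mult[symmetric]) (auto simp: field_simps)
  finally show ?thesis .
qed

section \<open>Morrey spaces\<close>

lemma cube_properties:
  assumes "Q \<in> (cubes :: (real ^ 'n) set set)"
  shows "Q \<in> sets lebesgue" "emeasure lebesgue Q < \<infinity>" "0 < measure lebesgue Q"
proof -
  obtain a :: "real ^ 'n" and l where Q: "Q = cbox a (a + (\<chi> i. l))" "0 < l"
    using assms by (auto simp: cubes_def)
  show "Q \<in> sets lebesgue" "emeasure lebesgue Q < \<infinity>"
    by (auto simp: Q emeasure_lborel_cbox_eq)
  show "0 < measure lebesgue Q"
    using Q(2) by (auto simp: Q(1) content_pos_lt_eq Basis_vec_def inner_axis inner_add_left)
qed

text \<open>
  This is the defining inequality of the weak norm, solved for the measure of the level set. The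
  norm is built from real-valued measures, so the passage back to extended values uses that a cube
  has finite measure.
\<close>

lemma weak_morrey_level_set_bound:
  fixes f :: "real ^ 'n \<Rightarrow> 'b::{real_normed_field, euclidean_space}"
  assumes f: "f \<in> weak_morrey_space p \<kappa>" and p: "0 < p" and Q: "Q \<in> cubes" and t: "0 < t"
  shows "emeasure lebesgue {y \<in> Q. t < norm (f y)} \<le>
    ennreal (enn2real (weak_morrey_norm p \<kappa> f) powr p * measure lebesgue Q powr \<kappa> * t powr - p)"
proof -
  let ?W = "enn2real (weak_morrey_norm p \<kappa> f)" and ?S = "{y \<in> Q. t < norm (f y)}"
  have [measurable]: "f \<in> borel_measurable lebesgue" and fin: "weak_morrey_norm p \<kappa> f < top"
    using f by (auto simp: weak_morrey_space_def)
  note [measurable] = cube_properties(1)[OF Q]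
  have S: "?S \<in> sets lebesgue"
  proof -
    have "?S = {y \<in> space lebesgue. y \<in> Q \<and> t < norm (f y)}" by simp
    also have "\<dots> \<in> sets lebesgue" by measurable
    finally show ?thesis .
  qed
  have "emeasure lebesgue ?S \<le> emeasure lebesgue Q"
    using cube_properties(1)[OF Q] by (intro emeasure_mono) auto
  then have Sfin: "emeasure lebesgue ?S < top"
    using cube_properties(2)[OF Q] by (simp add: order_le_less_trans)
  have "ennreal (1 / measure lebesgue Q powr (\<kappa> / p) * t * measure lebesgue ?S powr (1 / p))
      \<le> weak_morrey_norm p \<kappa> f"
    unfolding weak_morrey_norm_def by (rule SUP_upper2[OF Q], rule SUP_upper2[of t]) (use t in auto)
  then have "1 / measure lebesgue Q powr (\<kappa> / p) * t * measure lebesgue ?S powr (1 / p) \<le> ?W"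
    using fin by (rule le_enn2real_if_ennreal_le)
  then have "measure lebesgue ?S powr (1 / p) \<le> ?W * measure lebesgue Q powr (\<kappa> / p) / t"
    using t cube_properties(3)[OF Q] by (simp add: field_simps)
  then have "(measure lebesgue ?S powr (1 / p)) powr p
      \<le> (?W * measure lebesgue Q powr (\<kappa> / p) / t) powr p"
    using p by (intro powr_mono2) auto
  then have "measure lebesgue ?S \<le> ?W powr p * measure lebesgue Q powr \<kappa> * t powr - p"
    using p t by (simp add: powr_mult powr_divide powr_powr powr_minus_divide)
  then show ?thesis
    using Sfin by (simp add: emeasure_eq_ennreal_measure ennreal_leI less_top)
qed

lemma AE_norm_le_Linfty_norm:
  fixes f :: "real ^ 'n \<Rightarrow> 'b::{real_normed_field, euclidean_space}"
  assumes "f \<in> Linfty_space"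
  shows "AE y in lebesgue. norm (f y) \<le> enn2real (Linfty_norm f)"
proof -
  have fin: "Linfty_norm f < top"
    using assms by (simp add: Linfty_space_def)
  have "AE y in lebesgue. ennreal (norm (f y)) \<le> Linfty_norm f"
    unfolding Linfty_norm_def by (rule esssup_AE)
  then show ?thesis
    by eventually_elim (simp add: le_enn2real_if_ennreal_le fin)
qed

lemma Linfty_imp_locally_integrable:
  fixes f :: "real ^ 'n \<Rightarrow> 'b::{real_normed_field, euclidean_space}"
  assumes f: "f \<in> Linfty_space"
  shows "locally_integrable f"
  unfolding locally_integrable_def set_integrable_def
proof (intro allI impI integrableI_bounded_set_indicator)
  fix K :: "(real ^ 'n) set" assume K: "compact K"
  show "K \<in> sets lebesgue" using K by (simp add: lmeasurable_compact fmeasurableD)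
  show "f \<in> borel_measurable lebesgue" using f by (simp add: Linfty_space_def)
  show "emeasure lebesgue K < \<infinity>"
    using fmeasurableD2[OF lmeasurable_compact[OF K]] by (simp only: infinity_ennreal_def less_top)
  show "AE y in lebesgue. y \<in> K \<longrightarrow> norm (f y) \<le> enn2real (Linfty_norm f)"
    using AE_norm_le_Linfty_norm[OF f] by eventually_elim simp
qed

text \<open>
  The cut-off of \<open>\<bar>f\<bar>\<close> to \<open>Q\<close> has, for every positive height, the level sets that occur in the weak
  norm, so the abstract estimate applies on the whole space.
\<close>

lemma nn_integral_cube_powr_le:
  fixes f :: "real ^ 'n \<Rightarrow> 'b::{real_normed_field, euclidean_space}"
  assumes weak: "f \<in> weak_morrey_space p \<kappa>" and bounded: "f \<in> Linfty_space"
    and p: "0 < p" and pq: "p < q" and Q: "Q \<in> cubes"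
  shows "(\<integral>\<^sup>+y\<in>Q. ennreal (norm (f y) powr q) \<partial>lebesgue) \<le>
    ennreal (q / (q - p) * (enn2real (weak_morrey_norm p \<kappa> f) powr p * measure lebesgue Q powr \<kappa>) *
      enn2real (Linfty_norm f) powr (q - p))"
proof -
  let ?g = "\<lambda>y. norm (f y) * indicator Q y"
  have [measurable]: "f \<in> borel_measurable lebesgue"
    using bounded by (simp add: Linfty_space_def)
  note [measurable] = cube_properties(1)[OF Q]
  have "(\<integral>\<^sup>+y\<in>Q. ennreal (norm (f y) powr q) \<partial>lebesgue) = (\<integral>\<^sup>+y. ennreal (?g y powr q) \<partial>lebesgue)"
    using p pq by (intro nn_integral_cong) (auto simp: indicator_def)
  also have "\<dots> \<le> ennreal (q / (q - p) *
      (enn2real (weak_morrey_norm p \<kappa> f) powr p * measure lebesgue Q powr \<kappa>) *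
      enn2real (Linfty_norm f) powr (q - p))"
  proof (rule nn_integral_powr_le_of_weak_bound)
    show "sigma_finite_measure (lebesgue :: (real ^ 'n) measure)"
      by (rule sigma_finite_completion) (rule sigma_finite_lborel)
    show "?g \<in> borel_measurable lebesgue" by measurable
    show "AE y in lebesgue. 0 \<le> ?g y \<and> ?g y \<le> enn2real (Linfty_norm f)"
      using AE_norm_le_Linfty_norm[OF bounded] 
      by eventually_elim (auto simp: indicator_def)
    fix t :: real assume t: "0 < t"
    then have "{y \<in> space lebesgue. t < ?g y} = {y \<in> Q. t < norm (f y)}"
      by (auto simp: indicator_def split: if_splits)
    then show "emeasure lebesgue {y \<in> space lebesgue. t < ?g y} \<le>
        ennreal (enn2real (weak_morrey_norm p \<kappa> f) powr p * measure lebesgue Q powr \<kappa> * t powr - p)"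
      using weak_morrey_level_set_bound[OF weak p Q t] by simp
  qed (use p pq in auto)
  finally show ?thesis .
qed

theorem theorem2p8:
  fixes f :: "real ^ 'n \<Rightarrow> 'b::{real_normed_field, euclidean_space}"
    and p \<kappa> :: real
  assumes "1 \<le> p" and "0 < \<kappa>" and "\<kappa> < 1"
    and "f \<in> weak_morrey_space p \<kappa> \<inter> Linfty_space"
  shows "\<forall>q>p. f \<in> morrey_space q \<kappa> \<and>
    morrey_norm q \<kappa> f \<le>
      ennreal ((q / (q - p)) powr (1 / q)) *
      (weak_morrey_norm p \<kappa> f) powr\<^sub>e (p / q) *
      (Linfty_norm f) powr\<^sub>e (1 - p / q)"
proof (intro allI impI)
  fix q assume pq: "p < q"
  have weak: "f \<in> weak_morrey_space p \<kappa>" and bounded: "f \<in> Linfty_space"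
    using assms(4) by auto
  define W L where "W = enn2real (weak_morrey_norm p \<kappa> f)" and "L = enn2real (Linfty_norm f)"
  have W: "weak_morrey_norm p \<kappa> f = ennreal W" and L: "Linfty_norm f = ennreal L"
    using weak bounded by (auto simp: weak_morrey_space_def Linfty_space_def W_def L_def)
  have nonneg: "0 \<le> W" "0 \<le> L" by (auto simp: W_def L_def)
  let ?C = "(q / (q - p)) powr (1 / q) * W powr (p / q) * L powr (1 - p / q)"
  have "(ennreal (1 / measure lebesgue Q powr \<kappa>) *
      (\<integral>\<^sup>+y\<in>Q. ennreal (norm (f y) powr q) \<partial>lebesgue)) powr\<^sub>e (1 / q) \<le> ennreal ?C"
    if Q: "Q \<in> cubes" for Q
  proof -
    note pos = cube_properties(3)[OF Q]
    have "ennreal (1 / measure lebesgue Q powr \<kappa>) * (\<integral>\<^sup>+y\<in>Q. ennreal (norm (f y) powr q) \<partial>lebesgue)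
        \<le> ennreal (1 / measure lebesgue Q powr \<kappa>) *
          ennreal (q / (q - p) * (W powr p * measure lebesgue Q powr \<kappa>) * L powr (q - p))"
      unfolding W_def L_def using assms(1) pq weak bounded Q
      by (intro mult_left_mono nn_integral_cube_powr_le) auto
    also have "\<dots> = ennreal (q / (q - p) * W powr p * L powr (q - p))"
      using pos pq assms(1) by (subst ennreal_mult[symmetric]) (auto simp: field_simps)
    finally have "(ennreal (1 / measure lebesgue Q powr \<kappa>) *
        (\<integral>\<^sup>+y\<in>Q. ennreal (norm (f y) powr q) \<partial>lebesgue)) powr\<^sub>e (1 / q)
        \<le> ennreal (q / (q - p) * W powr p * L powr (q - p)) powr\<^sub>e (1 / q)"
      using pq assms(1) by (intro ennreal_powr_mono) auto
    also have "\<dots> = ennreal ((q / (q - p) * W powr p * L powr (q - p)) powr (1 / q))"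
      using pq assms(1) by (intro ennreal_powr_ennreal) auto
    also have "(q / (q - p) * W powr p * L powr (q - p)) powr (1 / q) =
        (q / (q - p)) powr (1 / q) * W powr (p / q) * L powr ((q - p) / q)"
      using pq assms(1) by (simp add: powr_mult powr_powr del: times_divide_eq_left)
    also have "(q - p) / q = 1 - p / q"
      using pq assms(1) by (simp add: field_simps)
    finally show ?thesis .
  qed
  then have "morrey_norm q \<kappa> f \<le> ennreal ?C"
    unfolding morrey_norm_def by (rule SUP_least)
  moreover have "ennreal ?C = ennreal ((q / (q - p)) powr (1 / q)) *
      (weak_morrey_norm p \<kappa> f) powr\<^sub>e (p / q) * (Linfty_norm f) powr\<^sub>e (1 - p / q)"
    using nonneg by (simp add: W L ennreal_powr_ennreal ennreal_mult)
  moreover have "f \<in> morrey_space q \<kappa>"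
    using Linfty_imp_locally_integrable[OF bounded] \<open>morrey_norm q \<kappa> f \<le> ennreal ?C\<close>
    by (auto simp: morrey_space_def intro: order_le_less_trans[OF _ ennreal_less_top])
  ultimately show "f \<in> morrey_space q \<kappa> \<and>
    morrey_norm q \<kappa> f \<le>
      ennreal ((q / (q - p)) powr (1 / q)) *
      (weak_morrey_norm p \<kappa> f) powr\<^sub>e (p / q) *
      (Linfty_norm f) powr\<^sub>e (1 - p / q)"
    by simp
qed

end
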